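(* Let $n\ge1$ and let $x,y$ be coprime integers with $1\le x<y$; set $d_k=x^{n-k}y^k$ for $k\in\{0,\dots,n+1\}$ (so $d_{n+1}=y^{n+1}/x$). Every integer $v\ge0$ has a unique decomposition of the form \[ v=\sum_{k=0}^{n}c_kd_k+c_{n+1}d_{n+1}\] with $c_k\in\{0,\dots,y-1\}$ for $k\in\{0,\dots,n\}$ and $c_{n+1}\in x\mathbb{Z}$. *)

theory Defs
  imports Complex_Main "HOL-Library.FuncSet"
begin

text \<open>The weights are rational numbers: for \<open>k = n + 1\<close> the exponent of \<open>x\<close> is \<open>-1\<close>,
  and \<open>d n x y (n + 1)\<close> is \<open>y ^ (n + 1) / x\<close>.\<close>

definition d :: "nat \<Rightarrow> int \<Rightarrow> int \<Rightarrow> nat \<Rightarrow> rat" where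
  "d n x y k = of_int x powi (int n - int k) * of_int y ^ k"

text \<open>A coefficient family \<open>(c\<^sub>0, \<dots>, c\<^sub>n\<^sub>+\<^sub>1)\<close> is a function with its values
  outside the index set \<open>{0..n+1}\<close> fixed (membership in \<open>extensional\<close>), so that
  uniqueness of the function is uniqueness of the family.\<close>

definition is_decomposition :: "nat \<Rightarrow> int \<Rightarrow> int \<Rightarrow> int \<Rightarrow> (nat \<Rightarrow> int) \<Rightarrow> bool" where
  "is_decomposition n x y v c \<longleftrightarrow>
     c \<in> extensional {0..n+1} \<and>
     (\<forall>k\<in>{0..n}. c k \<in> {0..y-1}) \<and>
     x dvd c (n+1) \<and>
     of_int v = (\<Sum>k=0..n. of_int (c k) * d n x y k) + of_int (c (n+1)) * d n x y (n+1)"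

end

theory Submission imports Defs "HOL-Number_Theory.Cong" begin

text \<open>Reducing modulo \<open>y\<close> determines \<open>c\<^sub>0\<close>, since \<open>x\<close> is invertible modulo \<open>y\<close>; subtracting
  \<open>c\<^sub>0 x\<^sup>n\<close> and dividing by \<open>y\<close> leaves the same problem with \<open>n\<close> replaced by \<open>n - 1\<close>.
  The last coefficient is an integer quotient of unrestricted sign.\<close>

text \<open>Integer form of the decomposition: \<open>N\<close> counts the bounded digits, so
  \<open>N = n + 1\<close> in the theorem, and \<open>m\<close> stands for the last coefficient
  divided by \<open>x\<close>.\<close>

definition expansion :: "nat \<Rightarrow> int \<Rightarrow> int \<Rightarrow> (nat \<Rightarrow> int) \<Rightarrow> int \<Rightarrow> int" where
  "expansion N x y c m = (\<Sum>k<N. c k * x ^ (N - 1 - k) * y ^ k) + m * y ^ N"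

lemma expansion_0 [simp]: "expansion 0 x y c m = m"
  by (simp add: expansion_def)

text \<open>A Horner step: every term but the first has a factor \<open>y\<close>, and the exponents
  of \<open>x\<close> are unchanged because \<open>N\<close> and \<open>k\<close> drop
  together.\<close>

lemma expansion_Suc:
  "expansion (Suc N) x y c m = c 0 * x ^ N + y * expansion N x y (\<lambda>k. c (Suc k)) m"
  unfolding expansion_def
  by (subst sum.lessThan_Suc_shift)
    (simp add: sum_distrib_left distrib_left mult_ac)

text \<open>The quotient \<open>w\<close> left after removing a digit can be negative even for
  positive \<open>v\<close>, so the induction runs over all integers \<open>v\<close>.\<close>

lemma expansion_exists:
  fixes x y v :: int
  assumes "coprime x y" and "0 < y"
  shows "\<exists>c m. (\<forall>k<N. c k \<in> {0..y-1}) \<and> v = expansion N x y c m"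
proof (induction N arbitrary: v)
  case 0
  then show ?case by simp
next
  case (Suc N)
  have "coprime (x ^ N) y" using assms by simp
  then obtain b where b: "[x ^ N * b = 1] (mod y)"
    using cong_solve_coprime_int by blast
  \<comment> \<open>As \<open>b\<close> inverts \<open>x ^ N\<close> modulo \<open>y\<close>, this
    is the only candidate for the lowest digit.\<close>
  define a where "a = (b * v) mod y"
  have "[a * x ^ N = (b * v) * x ^ N] (mod y)"
    unfolding a_def by (intro cong_mult) simp_all
  also have "[(b * v) * x ^ N = v] (mod y)"
    using cong_scalar_right[OF b, of v] by (simp add: mult_ac)
  finally have "y dvd v - a * x ^ N"
    by (metis cong_iff_dvd_diff cong_sym)
  then obtain w where w: "v - a * x ^ N = y * w" ..
  obtain c m where c: "\<forall>k<N. c k \<in> {0..y-1}" "w = expansion N x y c m"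
    using Suc by blast
  have "\<forall>k<Suc N. case_nat a c k \<in> {0..y-1}"
    using c(1) assms(2) by (auto simp: a_def split: nat.split)
  moreover have "v = expansion (Suc N) x y (case_nat a c) m"
    using w c(2) by (simp add: expansion_Suc)
  ultimately show ?case by blast
qed

lemma expansion_unique:
  fixes x y :: int
  assumes "coprime x y" and "0 < y"
    and "\<And>k. k < N \<Longrightarrow> c k \<in> {0..y-1}" and "\<And>k. k < N \<Longrightarrow> c' k \<in> {0..y-1}"
    and "expansion N x y c m = expansion N x y c' m'"
  shows "(\<forall>k<N. c k = c' k) \<and> m = m'"
  using assms(3-5)
proof (induction N arbitrary: c c')
  case 0
  then show ?case by simp
next
  case (Suc N)
  let ?e = "\<lambda>c m. expansion N x y (\<lambda>k. c (Suc k)) m"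
  have eq: "c 0 * x ^ N + y * ?e c m = c' 0 * x ^ N + y * ?e c' m'"
    using Suc.prems(3) by (simp add: expansion_Suc)
  then have "c 0 * x ^ N - c' 0 * x ^ N = y * (?e c' m' - ?e c m)"
    by (simp add: algebra_simps)
  then have "[c 0 * x ^ N = c' 0 * x ^ N] (mod y)"
    by (simp add: cong_iff_dvd_diff)
  then have "[c 0 = c' 0] (mod y)"
    using assms(1) by (simp add: cong_mult_rcancel)
  \<comment> \<open>Congruent residues in \<open>{0..y-1}\<close> coincide.\<close>
  then have c0: "c 0 = c' 0"
    using Suc.prems(1)[of 0] Suc.prems(2)[of 0] by (auto intro: cong_less_imp_eq_int)
  with eq assms(2) have "?e c m = ?e c' m'" by simp
  then have "(\<forall>k<N. c (Suc k) = c' (Suc k)) \<and> m = m'"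
    using Suc.prems(1,2) by (intro Suc.IH) auto
  with c0 show ?case by (auto simp: less_Suc_eq_0_disj)
qed

lemma d_le: "k \<le> n \<Longrightarrow> d n x y k = of_int (x ^ (n - k) * y ^ k)"
  by (simp add: d_def power_int_def nat_diff_distrib flip: of_nat_diff)

text \<open>The factor \<open>x\<close> of the coefficient cancels the exponent \<open>-1\<close> in
  the last weight, which makes the term an integer.\<close>

lemma d_Suc: "x \<noteq> 0 \<Longrightarrow> of_int (x * m) * d n x y (n + 1) = of_int (m * y ^ (n + 1))"
  by (simp add: d_def power_int_minus)

lemma decomposition_sum:
  fixes x y m :: int
  assumes "x \<noteq> 0" and "c (n + 1) = x * m"
  shows "(\<Sum>k=0..n. of_int (c k) * d n x y k) + of_int (c (n + 1)) * d n x y (n + 1)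
    = of_int (expansion (n + 1) x y c m)"
proof -
  have "(\<Sum>k=0..n. of_int (c k) * d n x y k)
      = of_int (\<Sum>k<n + 1. c k * x ^ (n - k) * y ^ k)"
    unfolding of_int_sum
    by (rule sum.cong) (auto simp: d_le mult.assoc)
  then show ?thesis
    unfolding assms(2) d_Suc[OF assms(1)] by (simp add: expansion_def)
qed

theorem theorem7:
  fixes n :: nat and x y v :: int
  assumes "n \<ge> 1"
    and "coprime x y"
    and "1 \<le> x"
    and "x < y"
    and "v \<ge> 0"
  shows "\<exists>!c. is_decomposition n x y v c"
proof -
  have x: "x \<noteq> 0" and y: "0 < y" using assms by auto
  \<comment> \<open>Injectivity of \<open>of_int\<close> turns the rational equation into one
    between integers.\<close>
  have iff: "is_decomposition n x y v c \<longleftrightarrow> c \<in> extensional {0..n+1} \<and>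
      (\<forall>k<n+1. c k \<in> {0..y-1}) \<and> (\<exists>m. c (n+1) = x * m \<and> v = expansion (n+1) x y c m)" for c
  proof -
    have "of_int v = (\<Sum>k=0..n. of_int (c k) * d n x y k) + of_int (c (n+1)) * d n x y (n+1)
        \<longleftrightarrow> v = expansion (n+1) x y c m" if "c (n+1) = x * m" for m
      unfolding decomposition_sum[of x c n m, OF x that] by (rule of_int_eq_iff)
    moreover have "(\<forall>k\<in>{0..n}. c k \<in> {0..y-1}) \<longleftrightarrow> (\<forall>k<n+1. c k \<in> {0..y-1})"
      by (auto simp: less_Suc_eq_le)
    ultimately show ?thesis
      unfolding is_decomposition_def dvd_def by blast
  qed
  obtain c m where c: "\<forall>k<n+1. c k \<in> {0..y-1}" "v = expansion (n+1) x y c m"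
    using expansion_exists[OF assms(2) y] by blast
  \<comment> \<open>\<open>expansion (n+1)\<close> reads only indices below \<open>n+1\<close>, so
    index \<open>n+1\<close> is free to hold the last coefficient.\<close>
  define c' where "c' = restrict (c(n+1 := x * m)) {0..n+1}"
  have "expansion (n+1) x y c' m = expansion (n+1) x y c m"
    unfolding expansion_def c'_def by (intro arg_cong2[where f = "(+)"] sum.cong) auto
  then have "is_decomposition n x y v c'"
    unfolding iff using c by (auto simp: c'_def)
  moreover have "c1 = c2"
    if "is_decomposition n x y v c1" "is_decomposition n x y v c2" for c1 c2
  proof -
    obtain m1 m2 where m: "c1 (n+1) = x * m1" "v = expansion (n+1) x y c1 m1"
      "c2 (n+1) = x * m2" "v = expansion (n+1) x y c2 m2"
      using \<open>is_decomposition n x y v c1\<close> \<open>is_decomposition n x y v c2\<close> unfolding iff by blast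
    have *: "(\<forall>k<n+1. c1 k = c2 k) \<and> m1 = m2"
      by (rule expansion_unique[OF assms(2) y]) (use that iff m in auto)
    show "c1 = c2"
    \<comment> \<open>Index \<open>n+1\<close> agrees because \<open>m1 = m2\<close>, the smaller
      ones by equality of digits.\<close>
    proof (rule extensionalityI[of _ "{0..n+1}"])
      show "c1 k = c2 k" if "k \<in> {0..n+1}" for k
        using * m that by (cases "k = n + 1") auto
    qed (use that iff in auto)
  qed
  ultimately show ?thesis by blast
qed

end
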